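(* Consider the dynamics $f$, the constraint set $\mathbb{Z}$, the stage cost $\ell$, the control law $\kappa$ and the finite-tail cost $V_{\mathrm{f},M}$ described in the context. Suppose that there exist constants $\rho\in[0,1)$, $C\geq 1$, $\epsilon>0$ such that for all $x\in\mathbb{X}$ with $\ell_{\min}(x)\leq\epsilon$ and all $k\in\mathbb{I}_{\geq 0}$, $$\ell_\kappa(\phi_{\mathrm{x}}(k,x))\leq C\rho^{k}\ell_{\min}(x),\qquad (\phi_{\mathrm{x}}(k,x),\phi_{\mathrm{u}}(k,x))\in\mathbb{Z}.$$ Then for any $M\in\mathbb{I}_{\geq1}$ and any $x\in\mathbb{X}$ satisfying $\ell_{\min}(x)\leq\epsilon$, we have $$\ell_{\min}(x)\leq V_{\mathrm{f},M}(x)\leq\gamma_M\ell_{\min}(x),\qquad \gamma_M:=\frac{1-\rho^M}{1-\rho}C,$$ $$V_{\mathrm{f},M+1}(x)-V_{\mathrm{f},M}(x)\leq C\rho^M\ell_{\min}(x).$$ If additionally $V_{\mathrm{f},M}(x)\leq\epsilon$ holds, then $$V_{\mathrm{f},M+1}(x)\leq(1+c_M)V_{\mathrm{f},M}(x),\qquad c_M:=\frac{C\rho^M(1-\rho)}{1-\rho^M}.$$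
   Context: Notation: $\mathbb{I}_{\geq a}$ denotes the integers $\geq a$, $\mathbb{I}_{[a,b]}$ the integers in $[a,b]$. Convention: $0^0=1$. Setup: $\mathbb{X}=\mathbb{R}^n$, $\mathbb{U}\subseteq\mathbb{R}^m$ is compact, $f:\mathbb{X}\times\mathbb{U}\to\mathbb{X}$ and $\ell:\mathbb{X}\times\mathbb{U}\to\mathbb{R}_{\geq0}$ are continuous, $f(0,0)=0$, $\mathbb{Z}\subseteq\mathbb{X}\times\mathbb{U}$ with $0\in\mathrm{int}(\mathbb{Z})$. Define $\ell_{\min}(x):=\inf_{u\in\mathbb{U}}\ell(x,u)$. The control law $\kappa:\mathbb{X}\to\mathbb{U}$ is a given continuous function and $\ell_\kappa(x):=\ell(x,\kappa(x))$. The response under $\kappa$ is defined by $\phi_{\mathrm{x}}(0,x):=x$, $\phi_{\mathrm{u}}(k,x):=\kappa(\phi_{\mathrm{x}}(k,x))$, $\phi_{\mathrm{x}}(k+1,x):=f(\phi_{\mathrm{x}}(k,x),\phi_{\mathrm{u}}(k,x))$ for $k\in\mathbb{I}_{\geq0}$. Finite-tail cost: for $M\in\mathbb{I}_{\geq1}$, $V_{\mathrm{f},M}(x):=\sum_{k=0}^{M-1}\ell_\kappa(\phi_{\mathrm{x}}(k,x))$ if $(\phi_{\mathrm{x}}(k,x),\phi_{\mathrm{u}}(k,x))\in\mathbb{Z}$ for all $k\in\mathbb{I}_{[0,M-1]}$, and $V_{\mathrm{f},M}(x):=\infty$ otherwise. *)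

theory Defs
  imports "HOL-Analysis.Analysis"
begin

text \<open>
  The maps \<open>f\<close> and \<open>\<ell>\<close> live on the product of the state and the input space; only their values
  on \<open>UNIV \<times> U\<close> matter, where \<open>U\<close> is the input constraint set.
\<close>

definition l_min :: "('x \<times> 'u \<Rightarrow> real) \<Rightarrow> 'u set \<Rightarrow> 'x \<Rightarrow> real" where
  "l_min l U x = (INF u\<in>U. l (x, u))"

definition l_kappa :: "('x \<times> 'u \<Rightarrow> real) \<Rightarrow> ('x \<Rightarrow> 'u) \<Rightarrow> 'x \<Rightarrow> real" where
  "l_kappa l \<kappa> x = l (x, \<kappa> x)"

text \<open>
  In the recursion for \<open>phi_x\<close>, the term \<open>\<kappa> (phi_x f \<kappa> k x)\<close> is \<open>phi_u f \<kappa> k x\<close>, written out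
  so that the definition is primitive recursive.
\<close>

primrec phi_x :: "('x \<times> 'u \<Rightarrow> 'x) \<Rightarrow> ('x \<Rightarrow> 'u) \<Rightarrow> nat \<Rightarrow> 'x \<Rightarrow> 'x" where
  "phi_x f \<kappa> 0 x = x"
| "phi_x f \<kappa> (Suc k) x = f (phi_x f \<kappa> k x, \<kappa> (phi_x f \<kappa> k x))"

definition phi_u :: "('x \<times> 'u \<Rightarrow> 'x) \<Rightarrow> ('x \<Rightarrow> 'u) \<Rightarrow> nat \<Rightarrow> 'x \<Rightarrow> 'u" where
  "phi_u f \<kappa> k x = \<kappa> (phi_x f \<kappa> k x)"

definition V_f ::
  "('x \<times> 'u \<Rightarrow> 'x) \<Rightarrow> ('x \<times> 'u) set \<Rightarrow> ('x \<times> 'u \<Rightarrow> real) \<Rightarrow> ('x \<Rightarrow> 'u) \<Rightarrow> nat \<Rightarrow> 'x \<Rightarrow> ereal"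
  where
  "V_f f Z l \<kappa> M x =
     (if \<forall>k<M. (phi_x f \<kappa> k x, phi_u f \<kappa> k x) \<in> Z
      then ereal (\<Sum>k<M. l_kappa l \<kappa> (phi_x f \<kappa> k x))
      else \<infinity>)"

definition gamma_M :: "real \<Rightarrow> real \<Rightarrow> nat \<Rightarrow> real" where
  "gamma_M \<rho> C M = (1 - \<rho> ^ M) / (1 - \<rho>) * C"

definition c_M :: "real \<Rightarrow> real \<Rightarrow> nat \<Rightarrow> real" where
  "c_M \<rho> C M = C * \<rho> ^ M * (1 - \<rho>) / (1 - \<rho> ^ M)"

end

(* The decay estimate along the closed loop gives the first three bounds by a geometric sum.
   For the last one, V_f <= epsilon forces l_min <= epsilon at each of the states x_0, ..., x_(M-1)
   of the trajectory, so the decay estimate can be restarted at each x_k. With l_k the k-th stage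
   cost, this gives rho^k l_M <= C rho^M l_k, and summing over k < M yields
   (1 - rho^M)/(1 - rho) l_M <= C rho^M V_(f,M). *)
theory Submission
  imports Defs
begin

text \<open>Time invariance of the closed loop: a response restarted at a visited state is the tail
  of the original one.\<close>

lemma phi_x_add: "phi_x f \<kappa> (j + k) x = phi_x f \<kappa> j (phi_x f \<kappa> k x)"
  by (induction j) simp_all

text \<open>Nonnegativity of the stage cost bounds the real infimum from below, so it lies under the
  value at the admissible input \<open>\<kappa> x\<close>.\<close>

lemma l_min_le_l_kappa:
  assumes "\<And>u. u \<in> U \<Longrightarrow> 0 \<le> l (x, u)" and "\<kappa> x \<in> U"
  shows "l_min l U x \<le> l_kappa l \<kappa> x"
  unfolding l_min_def l_kappa_def
  using assms by (intro cINF_lower bdd_belowI2[of U 0]) auto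

lemma V_f_eq_sum:
  assumes "\<And>k. (phi_x f \<kappa> k x, phi_u f \<kappa> k x) \<in> Z"
  shows "V_f f Z l \<kappa> M x = ereal (\<Sum>k<M. l_kappa l \<kappa> (phi_x f \<kappa> k x))"
  using assms by (simp add: V_f_def)

lemma sum_le_of_geometric_decay:
  fixes a :: "nat \<Rightarrow> real"
  assumes "\<rho> < 1" and "\<And>k. a k \<le> C * \<rho> ^ k * b"
  shows "(\<Sum>k<M. a k) \<le> gamma_M \<rho> C M * b"
proof -
  have "(\<Sum>k<M. a k) \<le> (\<Sum>k<M. C * \<rho> ^ k * b)"
    by (intro sum_mono assms)
  also have "\<dots> = C * (\<Sum>k<M. \<rho> ^ k) * b"
    by (simp add: sum_distrib_left sum_distrib_right)
  also have "\<dots> = gamma_M \<rho> C M * b"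
    using assms(1) by (simp add: sum_gp_strict gamma_M_def)
  finally show ?thesis .
qed

text \<open>Weighting the k-th bound by \<open>\<rho> ^ k\<close> gives all right-hand sides the
  common factor \<open>\<rho> ^ M\<close>. Multiplying, rather than dividing by powers of
  \<open>\<rho>\<close>, also covers \<open>\<rho> = 0\<close>.\<close>

lemma le_c_M_mult_sum:
  fixes a :: "nat \<Rightarrow> real"
  assumes "0 \<le> \<rho>" and "\<rho> < 1" and "M \<ge> 1"
    and "\<And>k. k < M \<Longrightarrow> a M \<le> C * \<rho> ^ (M - k) * a k"
  shows "a M \<le> c_M \<rho> C M * (\<Sum>k<M. a k)"
proof -
  have "\<rho> ^ k * a M \<le> C * \<rho> ^ M * a k" if "k < M" for k
  proof -
    have "\<rho> ^ k * a M \<le> \<rho> ^ k * (C * \<rho> ^ (M - k) * a k)"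
      using assms that by (intro mult_left_mono) auto
    also have "\<dots> = C * (\<rho> ^ k * \<rho> ^ (M - k)) * a k"
      by (simp add: algebra_simps)
    also have "\<rho> ^ k * \<rho> ^ (M - k) = \<rho> ^ M"
      using that by (simp flip: power_add)
    finally show ?thesis .
  qed
  then have "(\<Sum>k<M. \<rho> ^ k * a M) \<le> (\<Sum>k<M. C * \<rho> ^ M * a k)"
    by (intro sum_mono) simp
  then have "(1 - \<rho> ^ M) / (1 - \<rho>) * a M \<le> C * \<rho> ^ M * (\<Sum>k<M. a k)"
    using assms(2) by (simp add: sum_gp_strict flip: sum_distrib_left sum_distrib_right)
  \<comment> \<open>This is where \<open>M \<ge> 1\<close> matters: it makes the geometric sum
    positive, so that it can be divided out.\<close>
  moreover have "\<rho> ^ M < 1"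
    using assms by (simp add: power_less_one_iff)
  ultimately show ?thesis
    using assms(2) by (simp add: c_M_def field_simps)
qed

theorem proposition4:
  fixes f :: "(real ^ 'n) \<times> (real ^ 'm) \<Rightarrow> real ^ 'n"
    and l :: "(real ^ 'n) \<times> (real ^ 'm) \<Rightarrow> real"
    and U :: "(real ^ 'm) set"
    and Z :: "((real ^ 'n) \<times> (real ^ 'm)) set"
    and \<kappa> :: "real ^ 'n \<Rightarrow> real ^ 'm"
    and \<rho> C \<epsilon> :: real
  assumes "compact U"
    and "continuous_on (UNIV \<times> U) f"
    and "continuous_on (UNIV \<times> U) l"
    and "\<And>x u. u \<in> U \<Longrightarrow> 0 \<le> l (x, u)"
    and "f (0, 0) = 0"
    and "Z \<subseteq> UNIV \<times> U"
    and "(0, 0) \<in> interior Z"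
    and "continuous_on UNIV \<kappa>"
    and "\<And>x. \<kappa> x \<in> U"
    and "0 \<le> \<rho>" and "\<rho> < 1" and "C \<ge> 1" and "\<epsilon> > 0"
    and "\<And>x k. l_min l U x \<le> \<epsilon> \<Longrightarrow>
           l_kappa l \<kappa> (phi_x f \<kappa> k x) \<le> C * \<rho> ^ k * l_min l U x \<and>
           (phi_x f \<kappa> k x, phi_u f \<kappa> k x) \<in> Z"
  shows "\<forall>M\<ge>1. \<forall>x. l_min l U x \<le> \<epsilon> \<longrightarrow>
           ereal (l_min l U x) \<le> V_f f Z l \<kappa> M x \<and>
           V_f f Z l \<kappa> M x \<le> ereal (gamma_M \<rho> C M * l_min l U x) \<and>
           V_f f Z l \<kappa> (M + 1) x - V_f f Z l \<kappa> M x \<le> ereal (C * \<rho> ^ M * l_min l U x) \<and>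
           (V_f f Z l \<kappa> M x \<le> ereal \<epsilon> \<longrightarrow>
              V_f f Z l \<kappa> (M + 1) x \<le> ereal (1 + c_M \<rho> C M) * V_f f Z l \<kappa> M x)"
proof (intro allI impI)
  fix M :: nat and x :: "real ^ 'n"
  assume M: "1 \<le> M" and x: "l_min l U x \<le> \<epsilon>"
  define a where "a k = l_kappa l \<kappa> (phi_x f \<kappa> k x)" for k
  have decay: "a k \<le> C * \<rho> ^ k * l_min l U x" for k
    using assms(14)[OF x] by (simp add: a_def)
  have V: "V_f f Z l \<kappa> N x = ereal (\<Sum>k<N. a k)" for N
    unfolding a_def using assms(14)[OF x] by (intro V_f_eq_sum) simp
  have l_min_le: "l_min l U (phi_x f \<kappa> k x) \<le> a k" for k
    unfolding a_def using assms(4,9) by (intro l_min_le_l_kappa) auto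
  have nonneg: "0 \<le> a k" for k
    using assms(4,9) by (simp add: a_def l_kappa_def)
  have a_le_sum: "a k \<le> (\<Sum>k<M. a k)" if "k < M" for k
    using that nonneg by (intro member_le_sum) auto
  \<comment> \<open>The term for \<open>k = 0\<close>, the stage cost at \<open>x\<close> itself, is
    present since \<open>M\<close> is at least 1.\<close>
  have "l_min l U x \<le> (\<Sum>k<M. a k)"
    using l_min_le[of 0] a_le_sum[of 0] M by simp
  moreover have "(\<Sum>k<M. a k) \<le> gamma_M \<rho> C M * l_min l U x"
    using assms(11) decay by (rule sum_le_of_geometric_decay)
  moreover have "(\<Sum>k<M + 1. a k) \<le> (1 + c_M \<rho> C M) * (\<Sum>k<M. a k)"
    if le: "(\<Sum>k<M. a k) \<le> \<epsilon>"
  proof -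
    have "a M \<le> C * \<rho> ^ (M - k) * a k" if k: "k < M" for k
    proof -
      let ?y = "phi_x f \<kappa> k x"
      have "l_min l U ?y \<le> \<epsilon>"
        using l_min_le[of k] a_le_sum[OF k] le by linarith
      \<comment> \<open>From \<open>?y\<close>, \<open>M - k\<close> further steps lead to the state
        at time \<open>M\<close>, whose stage cost is \<open>a M\<close>.\<close>
      then have "l_kappa l \<kappa> (phi_x f \<kappa> (M - k) ?y) \<le> C * \<rho> ^ (M - k) * l_min l U ?y"
        using assms(14) by blast
      then have "a M \<le> C * \<rho> ^ (M - k) * l_min l U ?y"
        using k by (simp add: a_def flip: phi_x_add)
      also have "\<dots> \<le> C * \<rho> ^ (M - k) * a k"
        using assms(10,12) l_min_le by (intro mult_left_mono) auto
      finally show ?thesis .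
    qed
    with assms(10,11) M have "a M \<le> c_M \<rho> C M * (\<Sum>k<M. a k)"
      by (rule le_c_M_mult_sum)
    then show ?thesis
      by (simp add: algebra_simps)
  qed
  \<comment> \<open>By \<open>V\<close> all values of \<open>V_f\<close> are finite. The increment
    from \<open>M\<close> to \<open>M + 1\<close> is exactly \<open>a M\<close>, so
    \<open>decay\<close> at time \<open>M\<close> gives the third bound.\<close>
  ultimately show "ereal (l_min l U x) \<le> V_f f Z l \<kappa> M x \<and>
      V_f f Z l \<kappa> M x \<le> ereal (gamma_M \<rho> C M * l_min l U x) \<and>
      V_f f Z l \<kappa> (M + 1) x - V_f f Z l \<kappa> M x \<le> ereal (C * \<rho> ^ M * l_min l U x) \<and>
      (V_f f Z l \<kappa> M x \<le> ereal \<epsilon> \<longrightarrow>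
         V_f f Z l \<kappa> (M + 1) x \<le> ereal (1 + c_M \<rho> C M) * V_f f Z l \<kappa> M x)"
    using decay[of M] by (simp add: V)
qed

end
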